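(* The polytope $\mathsf P_{n,m}$ is indecomposable for all integers $n,m\ge 1$, and the polytope $\mathsf Q_{n,m}$ is indecomposable for all integers $n,m\ge1$ with $(n,m)\ne(2,2)$ and $(n,m)\neq(1,1)$.
   Context: Let $K_{n,m}$ be the complete bipartite graph with nodes $a_1,\dots,a_n,b_1,\dots,b_m$ and arcs $a_ib_j$. Let $\mathbb R^{n+m}$ have coordinates and standard basis vectors labeled by these nodes. Its graphical zonotope is the Minkowski sum of segments $\mathsf Z_{n,m}=\sum_{i=1}^n\sum_{j=1}^m[e_{a_i},e_{b_j}]\subset\mathbb R^{n+m}$. Define $$\mathsf P_{n,m}=\mathsf Z_{n,m}\cap\Big\{x:\sum_{j=1}^m x_{b_j}\le nm-1\Big\},\qquad \mathsf Q_{n,m}=\mathsf P_{n,m}\cap\Big\{x:\sum_{i=1}^n x_{a_i}\le nm-1\Big\}.$$ A polytope $\mathsf Q$ is a deformation of a polytope $\mathsf P$ if $\lambda\mathsf P=\mathsf Q+\mathsf R$ for some $\lambda>0$ and some polytope $\mathsf R$. A polytope $\mathsf P$ is indecomposable if its only deformations are $\lambda\mathsf P+t$ with $\lambda\ge0$ and $t$ a vector (in particular a point is indecomposable). *)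

theory Defs
  imports "HOL-Analysis.Analysis"
begin

(* The library predicate polytope also holds of the empty set, whereas polytopes are
   nonempty here; hence the explicit nonemptiness conditions. The sum of two sets is the
   Minkowski sum. *)

definition deformation_of :: "'a::euclidean_space set \<Rightarrow> 'a set \<Rightarrow> bool" where
  "deformation_of Q P \<longleftrightarrow> polytope Q \<and> Q \<noteq> {} \<and>
     (\<exists>c::real. c > 0 \<and> (\<exists>R. polytope R \<and> R \<noteq> {} \<and> (\<lambda>x. c *\<^sub>R x) ` P = Q + R))"

definition indecomposable :: "'a::euclidean_space set \<Rightarrow> bool" where
  "indecomposable P \<longleftrightarrow> polytope P \<and> P \<noteq> {} \<and>
     (\<forall>Q. deformation_of Q P \<longrightarrow> (\<exists>c::real. \<exists>t. c \<ge> 0 \<and> Q = (\<lambda>x. c *\<^sub>R x + t) ` P))"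

(* The node a_i is Inl i and the node b_j is Inr j, so that n = CARD('n) and m = CARD('m),
   both at least 1. *)

definition graphical_zonotope :: "(real ^ ('n::finite + 'm::finite)) set" where
  "graphical_zonotope =
     (\<Sum>i\<in>(UNIV :: 'n set). \<Sum>j\<in>(UNIV :: 'm set).
        closed_segment (axis (Inl i) 1) (axis (Inr j) 1))"

definition P_polytope :: "(real ^ ('n::finite + 'm::finite)) set" where
  "P_polytope = graphical_zonotope \<inter>
     {x. (\<Sum>j\<in>(UNIV :: 'm set). x $ Inr j) \<le> real CARD('n) * real CARD('m) - 1}"

definition Q_polytope :: "(real ^ ('n::finite + 'm::finite)) set" where
  "Q_polytope = P_polytope \<inter>
     {x. (\<Sum>i\<in>(UNIV :: 'n set). x $ Inl i) \<le> real CARD('n) * real CARD('m) - 1}"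

end

theory Submission
  imports Defs
begin

text \<open>The zonotope is the image of the cube of flows \<open>f :: 'n \<times> 'm \<Rightarrow> [0, 1]\<close>, and both polytopes
  arise from it by bounding the total flow: \<open>1 \<le> sum f\<close> for \<open>P\<close>, and also \<open>sum f \<le> n m - 1\<close> for
  \<open>Q\<close>. All their vertices come from sets \<open>F\<close> of cells whose rows form a chain (the acyclic
  orientations). A Minkowski summand of a dilate sends each exposed edge to a nonnegative multiple of
  itself, so it suffices to show that these multiples agree. Removing a cell \<open>c\<close> from \<open>F\<close> is an edge;
  parallelograms transport its factor when another cell is removed from \<open>F\<close>, down to sets of two
  cells. There a triangle at the truncated vertex compares it with the factor of the new edge
  between the singletons of two cells in a line. Factors of two such edges that share a singleton
  agree by a triangle or, around a corner of a \<open>2 \<times> 2\<close> rectangle, by a chain of parallelograms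
  through that rectangle. Only for \<open>Q\<close> with \<open>n = m = 2\<close> is the full rectangle cut off.\<close>

section \<open>Nested sets of cells\<close>

text \<open>Orient the arc of a cell towards its \<open>a\<close>-node if the cell belongs to \<open>F\<close>, and towards its
  \<open>b\<close>-node otherwise. Then \<open>F\<close> is nested iff there is no directed 4-cycle, which for a complete
  bipartite graph means that the orientation is acyclic.\<close>

definition nested :: "('n \<times> 'm) set \<Rightarrow> bool" where
  "nested F \<longleftrightarrow> (\<forall>i j i' j'. (i, j) \<in> F \<longrightarrow> (i', j') \<in> F \<longrightarrow> (i, j') \<in> F \<or> (i', j) \<in> F)"

definition collinear_cells :: "'n \<times> 'm \<Rightarrow> 'n \<times> 'm \<Rightarrow> bool" where
  "collinear_cells c d \<longleftrightarrow> c \<noteq> d \<and> (fst c = fst d \<or> snd c = snd d)"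

lemma collinear_cells_sym: "collinear_cells c d \<Longrightarrow> collinear_cells d c"
  by (auto simp: collinear_cells_def)

lemma nested_singleton [simp]: "nested {c}"
  by (auto simp: nested_def)

lemma nested_pair_iff: "c \<noteq> d \<Longrightarrow> nested {c, d} \<longleftrightarrow> collinear_cells c d"
  by (cases c; cases d) (auto simp: nested_def collinear_cells_def)

lemma nested_rows:
  assumes "nested F"
  shows "F `` {i} \<subseteq> F `` {i'} \<or> F `` {i'} \<subseteq> F `` {i}"
proof (rule ccontr)
  assume "\<not> ?thesis"
  then obtain j j' where "(i, j) \<in> F" "(i', j) \<notin> F" "(i', j') \<in> F" "(i, j') \<notin> F" by auto
  with assms show False unfolding nested_def by metis
qed

text \<open>Removing \<open>(i, j)\<close> can only spoil a pair of cells for which it was the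
  witness, that is \<open>(i, l)\<close> and \<open>(k, j)\<close>; the opposite corner
  \<open>(k, l)\<close> then has to serve instead.\<close>

lemma nested_remove_iff:
  assumes "nested F"
  shows "nested (F - {(i, j)}) \<longleftrightarrow>
    (\<forall>k l. (i, l) \<in> F \<longrightarrow> l \<noteq> j \<longrightarrow> (k, j) \<in> F \<longrightarrow> k \<noteq> i \<longrightarrow> (k, l) \<in> F)"
    (is "_ \<longleftrightarrow> ?R")
proof
  assume "nested (F - {(i, j)})"
  then have "(i, l) \<in> F - {(i, j)} \<Longrightarrow> (k, j) \<in> F - {(i, j)} \<Longrightarrow>
      (i, j) \<in> F - {(i, j)} \<or> (k, l) \<in> F - {(i, j)}" for k l
    unfolding nested_def by metis
  then show ?R by auto
next
  assume R: ?R
  show "nested (F - {(i, j)})"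
    unfolding nested_def
  proof (intro allI impI)
    fix k l k' l'
    assume kl: "(k, l) \<in> F - {(i, j)}" "(k', l') \<in> F - {(i, j)}"
    then have "(k, l') \<in> F \<or> (k', l) \<in> F"
      using assms unfolding nested_def by (metis DiffD1)
    with kl R[rule_format, of l k'] R[rule_format, of l' k]
    show "(k, l') \<in> F - {(i, j)} \<or> (k', l) \<in> F - {(i, j)}" by auto
  qed
qed

text \<open>In a chain, a row of least cardinality is least for inclusion. Empty rows are left out
  so that the row found contains a cell to remove.\<close>

lemma minimal_row:
  fixes F :: "('n::finite \<times> 'm::finite) set"
  assumes F: "nested F" and I: "Domain F \<inter> I \<noteq> {}"
  obtains i where "i \<in> Domain F" "i \<in> I"
    "\<forall>k \<in> Domain F \<inter> I. F `` {i} \<subseteq> F `` {k}"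
proof -
  obtain i where i: "i \<in> Domain F \<inter> I"
    and le: "\<forall>k \<in> Domain F \<inter> I. card (F `` {i}) \<le> card (F `` {k})"
    using I ex_has_least_nat[of "\<lambda>k. k \<in> Domain F \<inter> I" _ "\<lambda>k. card (F `` {k})"] by (metis ex_in_conv)
  have "F `` {i} \<subseteq> F `` {k}" if "k \<in> Domain F \<inter> I" for k
    using nested_rows[OF F, of i k] bspec[OF le that]
    by (metis card_seteq finite subset_refl)
  with i show thesis by (intro that) auto
qed

text \<open>Any cell of a least nonempty row works: every row through its column contains that whole
  row.\<close>

lemma nested_removable:
  fixes F :: "('n::finite \<times> 'm::finite) set"
  assumes F: "nested F" and "F \<noteq> {}"
  obtains c where "c \<in> F" "nested (F - {c})"
proof -
  have "Domain F \<inter> UNIV \<noteq> {}" using \<open>F \<noteq> {}\<close> by auto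
  then obtain i where "i \<in> Domain F" and min: "\<forall>k \<in> Domain F \<inter> UNIV. F `` {i} \<subseteq> F `` {k}"
    by (rule minimal_row[OF F])
  then obtain j where j: "(i, j) \<in> F" by blast
  have "nested (F - {(i, j)})"
    unfolding nested_remove_iff[OF F]
  proof (intro allI impI)
    fix k l assume *: "(i, l) \<in> F" "(k, j) \<in> F"
    then have "F `` {i} \<subseteq> F `` {k}" using min by (simp add: DomainI)
    with * show "(k, l) \<in> F" by auto
  qed
  with j show thesis by (rule that)
qed

text \<open>Supplies the parallelograms used below. If all cells lie in the row of \<open>c\<close>,
  any other cell will do; otherwise \<open>d\<close> is taken from a least nonempty row among the
  other rows.\<close>

lemma nested_removable2:
  fixes F :: "('n::finite \<times> 'm::finite) set"
  assumes F: "nested F" and c: "c \<in> F" "nested (F - {c})" "F \<noteq> {c}"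
  obtains d where "d \<in> F" "d \<noteq> c" "nested (F - {d})" "nested (F - {c} - {d})"
proof -
  obtain i0 j0 where c_eq: "c = (i0, j0)" by (cases c)
  show thesis
  proof (cases "Domain F \<inter> - {i0} = {}")
    case True
    then have row: "k = i0" if "(k, l) \<in> F" for k l using that by auto
    obtain i j where ij: "(i, j) \<in> F" "(i, j) \<noteq> c" using c by auto
    have j: "(i0, j) \<in> F" "j \<noteq> j0" using ij row[OF ij(1)] by (auto simp: c_eq)
    have "nested (F - {(i0, j)})" "nested (F - {c} - {(i0, j)})"
      unfolding nested_remove_iff[OF F] nested_remove_iff[OF c(2)] using row by (meson DiffD1)+
    moreover have "(i0, j) \<noteq> c" using j(2) by (simp add: c_eq)
    ultimately show thesis using j(1) by (intro that)
  next
    case False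
    then obtain i where i: "i \<in> Domain F" "i \<in> - {i0}"
      and min: "\<forall>k \<in> Domain F \<inter> - {i0}. F `` {i} \<subseteq> F `` {k}"
      by (rule minimal_row[OF F])
    have min': "(k, l) \<in> F" if "(k, l') \<in> F" "(i, l) \<in> F" "k \<noteq> i0" for k l l'
    proof -
      have "F `` {i} \<subseteq> F `` {k}" using min that by (simp add: DomainI)
      with that show ?thesis by auto
    qed
    have rows: "(F - {c}) `` {i} = F `` {i}" "(F - {c}) `` {i0} = F `` {i0} - {j0}"
      using i(2) by (auto simp: c_eq)
    have j0: "j0 \<in> F `` {i0}" using c(1) by (simp add: c_eq)
    \<comment> \<open>These cases follow from the chain condition for \<open>F\<close> and for
      \<open>F - {c}\<close>. In the first, any column serves. In the second, \<open>j0\<close>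
      serves, because without \<open>c\<close> row \<open>i0\<close> has no cell in that column. In
      the third, a column missing from row \<open>i0\<close> serves.\<close>
    consider "F `` {i} \<subseteq> F `` {i0} - {j0}" | "F `` {i} = F `` {i0}" | "F `` {i0} \<subset> F `` {i}"
      using nested_rows[OF F, of i i0] nested_rows[OF c(2), of i i0] j0
      unfolding rows by blast
    then obtain j where j: "(i, j) \<in> F"
      and i0: "(i0, j) \<in> F \<Longrightarrow> F `` {i} - {j} \<subseteq> F `` {i0}"
        "(i0, j) \<in> F \<Longrightarrow> j \<noteq> j0 \<Longrightarrow> F `` {i} - {j} \<subseteq> F `` {i0} - {j0}"
    proof cases
      case 1
      obtain j where "(i, j) \<in> F" using i by auto
      with 1 show thesis by (intro that[of j]) auto
    next
      case 2
      with j0 show thesis by (intro that[of j0]) auto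
    next
      case 3
      then obtain j where "(i, j) \<in> F" "(i0, j) \<notin> F" by auto
      then show thesis by (intro that[of j]) auto
    qed
    have "nested (F - {(i, j)})"
      unfolding nested_remove_iff[OF F]
    proof (intro allI impI)
      fix k l assume "(i, l) \<in> F" "l \<noteq> j" "(k, j) \<in> F"
      then show "(k, l) \<in> F" using i0(1) min'[of k j l] by (cases "k = i0") auto
    qed
    moreover have "nested (F - {c} - {(i, j)})"
      unfolding nested_remove_iff[OF c(2)]
    proof (intro allI impI)
      fix k l assume "(i, l) \<in> F - {c}" "l \<noteq> j" "(k, j) \<in> F - {c}"
      then show "(k, l) \<in> F - {c}"
        using i0(2) min'[of k j l] by (cases "k = i0") (auto simp: c_eq)
    qed
    moreover have "(i, j) \<noteq> c" using i(2) by (simp add: c_eq)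
    ultimately show thesis using j by (intro that)
  qed
qed

text \<open>Every row missing column \<open>j\<close> is a proper subset of every row containing it,
  so with row sizes as \<alpha> there is room for \<open>\<beta> j\<close> between the two kinds of
  rows.\<close>

lemma nested_heights:
  fixes F :: "('n::finite \<times> 'm::finite) set"
  assumes "nested F"
  shows "\<exists>(\<alpha> :: 'n \<Rightarrow> real) (\<beta> :: 'm \<Rightarrow> real). \<forall>i j.
    ((i, j) \<in> F \<longrightarrow> \<beta> j < \<alpha> i) \<and> ((i, j) \<notin> F \<longrightarrow> \<alpha> i < \<beta> j)"
proof -
  define \<alpha> where "\<alpha> i = real (card (F `` {i}))" for i
  \<comment> \<open>The entry \<open>-1\<close> keeps the maximum defined when every row contains
    column \<open>j\<close>. Row sizes are integers, so adding \<open>1 / 2\<close> to the maximum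
    lands strictly between the two kinds.\<close>
  define A where "A j = insert (-1) (\<alpha> ` {i. (i, j) \<notin> F})" for j
  define \<beta> where "\<beta> j = Max (A j) + 1 / 2" for j
  have fin: "finite (A j)" "A j \<noteq> {}" for j by (auto simp: A_def)
  have "\<beta> j < \<alpha> i" if ij: "(i, j) \<in> F" for i j
  proof -
    have "x \<le> \<alpha> i - 1" if "x \<in> A j" for x
    proof (cases "x = -1")
      case False
      then obtain i' where i': "(i', j) \<notin> F" "x = \<alpha> i'" using \<open>x \<in> A j\<close> by (auto simp: A_def)
      then have "F `` {i'} \<subset> F `` {i}" using nested_rows[OF assms, of i' i] ij by auto
      then have "card (F `` {i'}) < card (F `` {i})" by (simp add: psubset_card_mono)
      then show ?thesis by (simp add: \<alpha>_def i')
    qed (simp add: \<alpha>_def)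
    then have "Max (A j) \<le> \<alpha> i - 1" using fin by (subst Max_le_iff) auto
    then show ?thesis by (simp add: \<beta>_def)
  qed
  moreover have "\<alpha> i < \<beta> j" if "(i, j) \<notin> F" for i j
  proof -
    have "\<alpha> i \<le> Max (A j)" using fin that by (intro Max_ge) (auto simp: A_def)
    then show ?thesis by (simp add: \<beta>_def)
  qed
  ultimately show ?thesis by (intro exI[of _ \<alpha>] exI[of _ \<beta>]) simp
qed

text \<open>A combination of separating heights for \<open>F\<close> and for \<open>F - {c}\<close> makes exactly the cell \<open>c\<close> tie.\<close>

lemma nested_corner_heights:
  fixes F :: "('n::finite \<times> 'm::finite) set"
  assumes F: "nested F" "nested (F - {c})" and c: "c \<in> F"
  shows "\<exists>(\<alpha> :: 'n \<Rightarrow> real) (\<beta> :: 'm \<Rightarrow> real). \<alpha> (fst c) = \<beta> (snd c) \<and>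
    (\<forall>d. (d \<in> F - {c} \<longrightarrow> \<beta> (snd d) < \<alpha> (fst d)) \<and> (d \<notin> F \<longrightarrow> \<alpha> (fst d) < \<beta> (snd d)))"
proof -
  obtain \<alpha>1 :: "'n \<Rightarrow> real" and \<beta>1 :: "'m \<Rightarrow> real" where 1:
    "\<forall>i j. ((i, j) \<in> F \<longrightarrow> \<beta>1 j < \<alpha>1 i) \<and> ((i, j) \<notin> F \<longrightarrow> \<alpha>1 i < \<beta>1 j)"
    using nested_heights[OF F(1)] by (elim exE)
  obtain \<alpha>2 :: "'n \<Rightarrow> real" and \<beta>2 :: "'m \<Rightarrow> real" where 2:
    "\<forall>i j. ((i, j) \<in> F - {c} \<longrightarrow> \<beta>2 j < \<alpha>2 i) \<and> ((i, j) \<notin> F - {c} \<longrightarrow> \<alpha>2 i < \<beta>2 j)"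
    using nested_heights[OF F(2)] by (elim exE)
  \<comment> \<open>At \<open>c\<close> the gap \<alpha> - \<beta> is \<open>t\<close> for the first
    heights and \<open>-s\<close> for the second, so the weights \<open>s\<close> and
    \<open>t\<close> make it cancel; at the cells of \<open>F - {c}\<close> and at those outside
    \<open>F\<close> both gaps have the same sign.\<close>
  define s where "s = \<beta>2 (snd c) - \<alpha>2 (fst c)"
  define t where "t = \<alpha>1 (fst c) - \<beta>1 (snd c)"
  have s: "s > 0" using 2[rule_format, of "fst c" "snd c"] by (simp add: s_def)
  have t: "t > 0" using 1[rule_format, of "fst c" "snd c"] c by (simp add: t_def)
  define \<alpha> where "\<alpha> i = s * \<alpha>1 i + t * \<alpha>2 i" for i
  define \<beta> where "\<beta> j = s * \<beta>1 j + t * \<beta>2 j" for j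
  show ?thesis
  proof (intro exI[of _ \<alpha>] exI[of _ \<beta>] conjI allI impI)
    show "\<alpha> (fst c) = \<beta> (snd c)"
      by (simp add: \<alpha>_def \<beta>_def s_def t_def algebra_simps)
    show "\<beta> (snd d) < \<alpha> (fst d)" if "d \<in> F - {c}" for d
      using 1[rule_format, of "fst d" "snd d"] 2[rule_format, of "fst d" "snd d"] that s t
      by (simp add: \<alpha>_def \<beta>_def add_strict_mono)
    show "\<alpha> (fst d) < \<beta> (snd d)" if "d \<notin> F" for d
      using 1[rule_format, of "fst d" "snd d"] 2[rule_format, of "fst d" "snd d"] that s t
      by (simp add: \<alpha>_def \<beta>_def add_strict_mono)
  qed
qed

section \<open>Comparing the edge factors\<close>

definition arc_vec :: "'n::finite \<times> 'm::finite \<Rightarrow> real ^ ('n + 'm)" where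
  "arc_vec c = axis (Inl (fst c)) 1 - axis (Inr (snd c)) 1"

lemma arc_vec_nth [simp]:
  "arc_vec c $ Inl i = of_bool (i = fst c)" "arc_vec c $ Inr j = - of_bool (j = snd c)"
  by (auto simp: arc_vec_def axis_def)

lemma arc_vec_neq_0 [simp]: "arc_vec c \<noteq> 0"
  by (auto simp: vec_eq_iff intro!: exI[of _ "Inl (fst c)"])

lemma arc_vec_independent:
  assumes "c \<noteq> d" "a *\<^sub>R arc_vec c = b *\<^sub>R arc_vec d"
  shows "a = 0" "b = 0"
proof -
  have *: "(a *\<^sub>R arc_vec c) $ x = (b *\<^sub>R arc_vec d) $ x" for x using assms(2) by simp
  from assms(1) have "fst c \<noteq> fst d \<or> snd c \<noteq> snd d" by (simp add: prod_eq_iff)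
  then have "a = 0 \<and> b = 0"
    using *[of "Inl (fst c)"] *[of "Inr (snd c)"] *[of "Inl (fst d)"] *[of "Inr (snd d)"]
    by auto
  then show "a = 0" "b = 0" by auto
qed

text \<open>The endpoint of \<open>c\<close> that is not common to the line belongs to neither
  \<open>d\<close> nor \<open>e\<close>; comparing this coordinate gives the claim.\<close>

lemma arc_vec_independent3:
  assumes "c \<noteq> d" "d \<noteq> e" "c \<noteq> e" "fst c = fst d \<and> fst d = fst e \<or> snd c = snd d \<and> snd d = snd e"
    and eq: "x *\<^sub>R (arc_vec c - arc_vec d) + y *\<^sub>R (arc_vec d - arc_vec e) = z *\<^sub>R (arc_vec c - arc_vec e)"
  shows "x = z"
proof -
  have *: "(x *\<^sub>R (arc_vec c - arc_vec d) + y *\<^sub>R (arc_vec d - arc_vec e)) $ v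
    = (z *\<^sub>R (arc_vec c - arc_vec e)) $ v" for v using eq by simp
  show ?thesis
    using *[of "Inl (fst c)"] *[of "Inr (snd c)"] assms(1-4) by (auto simp: prod_eq_iff)
qed

text \<open>What remains of a summand once polytopes are forgotten: \<open>q F\<close> is its point
  over the vertex of \<open>F\<close>, and \<open>removal\<close> and \<open>exchange\<close>
  describe the two kinds of edges. The condition \<open>F \<noteq> {c}\<close> keeps away from the
  empty set, whose vertex is cut off; \<open>K_rectangle\<close> keeps full rectangles.\<close>

locale rigid_vertices =
  fixes K :: nat and q :: "('n::finite \<times> 'm::finite) set \<Rightarrow> real ^ ('n + 'm)"
  assumes K_pos: "1 \<le> K"
    and K_rectangle: "\<And>(i :: 'n) i' (j :: 'm) j'. i \<noteq> i' \<Longrightarrow> j \<noteq> j' \<Longrightarrow> 4 \<le> K"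
    and removal: "\<And>F c. nested F \<Longrightarrow> card F \<le> K \<Longrightarrow> c \<in> F \<Longrightarrow> nested (F - {c}) \<Longrightarrow> F \<noteq> {c} \<Longrightarrow>
      \<exists>t\<ge>0. q F - q (F - {c}) = t *\<^sub>R arc_vec c"
    and exchange: "\<And>c d. collinear_cells c d \<Longrightarrow>
      \<exists>t\<ge>0. q {c} - q {d} = t *\<^sub>R (arc_vec c - arc_vec d)"
begin

definition \<kappa> :: "('n \<times> 'm) set \<Rightarrow> 'n \<times> 'm \<Rightarrow> real" where
  "\<kappa> F c = (SOME t. 0 \<le> t \<and> q F - q (F - {c}) = t *\<^sub>R arc_vec c)"

definition w :: "'n \<times> 'm \<Rightarrow> 'n \<times> 'm \<Rightarrow> real" where
  "w c d = (SOME t. 0 \<le> t \<and> q {c} - q {d} = t *\<^sub>R (arc_vec c - arc_vec d))"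

lemma \<kappa>:
  assumes "nested F" "card F \<le> K" "c \<in> F" "nested (F - {c})" "F \<noteq> {c}"
  shows "q F - q (F - {c}) = \<kappa> F c *\<^sub>R arc_vec c"
  using someI_ex[OF removal[OF assms]] by (simp add: \<kappa>_def)

lemma w:
  assumes "collinear_cells c d"
  shows "0 \<le> w c d" "q {c} - q {d} = w c d *\<^sub>R (arc_vec c - arc_vec d)"
  using someI_ex[OF exchange[OF assms]] by (simp_all add: w_def)

lemma w_sym:
  assumes "collinear_cells c d"
  shows "w c d = w d c"
proof -
  have "c \<noteq> d" using assms by (simp add: collinear_cells_def)
  then have "arc_vec c \<noteq> arc_vec d" using arc_vec_independent(1)[of c d 1 1] by auto
  moreover have "w c d *\<^sub>R (arc_vec c - arc_vec d) = - (w d c *\<^sub>R (arc_vec d - arc_vec c))"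
    unfolding w(2)[OF assms, symmetric] w(2)[OF collinear_cells_sym[OF assms], symmetric] by simp
  then have "w c d *\<^sub>R (arc_vec c - arc_vec d) = w d c *\<^sub>R (arc_vec c - arc_vec d)"
    by (simp flip: scaleR_minus_right)
  ultimately show ?thesis by simp
qed

text \<open>The two paths from \<open>F\<close> to \<open>F - {c} - {d}\<close> have the same sum,
  and \<open>arc_vec c\<close> and \<open>arc_vec d\<close> are independent, so opposite edges have
  equal factors.\<close>

lemma parallelogram:
  assumes F: "nested F" "card F \<le> K" and cd: "c \<in> F" "d \<in> F" "c \<noteq> d" "F \<noteq> {c, d}"
    and n: "nested (F - {c})" "nested (F - {d})" "nested (F - {c} - {d})"
  shows "\<kappa> F c = \<kappa> (F - {d}) c"
proof -
  have comm: "F - {d} - {c} = F - {c} - {d}" by blast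
  have card: "card (F - {c}) \<le> K" "card (F - {d}) \<le> K"
    using F(2) by (meson card_Diff1_le le_trans)+
  have ne: "F \<noteq> {c}" "F \<noteq> {d}" using cd by auto
  have ne': "F - {c} \<noteq> {d}" "F - {d} \<noteq> {c}"
    using cd by (metis insert_Diff, metis insert_Diff insert_commute)
  have mem: "d \<in> F - {c}" "c \<in> F - {d}" using cd by auto
  note e1 = \<kappa>[OF F cd(1) n(1) ne(1)]
  note e2 = \<kappa>[OF F cd(2) n(2) ne(2)]
  note e3 = \<kappa>[OF n(1) card(1) mem(1) n(3) ne'(1)]
  note e4 = \<kappa>[OF n(2) card(2) mem(2) n(3)[folded comm] ne'(2), unfolded comm]
  have "(\<kappa> F c - \<kappa> (F - {d}) c) *\<^sub>R arc_vec c = (\<kappa> F d - \<kappa> (F - {c}) d) *\<^sub>R arc_vec d"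
    unfolding scaleR_left_diff_distrib e1[symmetric] e2[symmetric] e3[symmetric] e4[symmetric] by simp
  from arc_vec_independent(1)[OF cd(3) this] show ?thesis by simp
qed

text \<open>Links the two kinds of edges: the exchange edge is the difference of the two removal
  edges at \<open>{c, d}\<close>, and independence allows comparing the coefficients of
  \<open>arc_vec c\<close>.\<close>

lemma triangle:
  assumes "collinear_cells c d" "2 \<le> K"
  shows "\<kappa> {c, d} c = w c d"
proof -
  have cd: "c \<noteq> d" "nested {c, d}"
    using assms nested_pair_iff[of c d] by (simp_all add: collinear_cells_def)
  have sets: "{c, d} - {c} = {d}" "{c, d} - {d} = {c}" "card {c, d} \<le> K" "{c, d} \<noteq> {c}" "{c, d} \<noteq> {d}"
    using cd assms(2) by auto
  have e: "q {c, d} - q {d} = \<kappa> {c, d} c *\<^sub>R arc_vec c" "q {c, d} - q {c} = \<kappa> {c, d} d *\<^sub>R arc_vec d"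
    using \<kappa>[of "{c, d}" c] \<kappa>[of "{c, d}" d] cd sets by simp_all
  have "\<kappa> {c, d} c *\<^sub>R arc_vec c - \<kappa> {c, d} d *\<^sub>R arc_vec d = w c d *\<^sub>R (arc_vec c - arc_vec d)"
    unfolding e[symmetric] w(2)[OF assms(1), symmetric] by simp
  then have "(\<kappa> {c, d} c - w c d) *\<^sub>R arc_vec c = (\<kappa> {c, d} d - w c d) *\<^sub>R arc_vec d"
    by (simp add: algebra_simps)
  from arc_vec_independent(1)[OF cd(1) this] show ?thesis by simp
qed

text \<open>Two cells that are collinear with \<open>c\<close> along the same line form a triangle with it. Otherwise
  the three cells span a \<open>2 \<times> 2\<close> rectangle, and the edge removing \<open>c\<close> is moved by parallelograms
  from one pair of cells through the full rectangle to the other pair.\<close>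

lemma w_adjacent:
  assumes "collinear_cells c d" "collinear_cells c e"
  shows "w c d = w c e"
proof (cases "d = e \<or> fst c = fst d \<and> fst d = fst e \<or> snd c = snd d \<and> snd d = snd e")
  case True
  show ?thesis
  proof (cases "d = e")
    case False
    with True assms have "collinear_cells d e" and line: "c \<noteq> d" "d \<noteq> e" "c \<noteq> e"
      "fst c = fst d \<and> fst d = fst e \<or> snd c = snd d \<and> snd d = snd e"
      by (auto simp: collinear_cells_def)
    have "w c d *\<^sub>R (arc_vec c - arc_vec d) + w d e *\<^sub>R (arc_vec d - arc_vec e)
        = w c e *\<^sub>R (arc_vec c - arc_vec e)"
      unfolding w(2)[OF assms(1), symmetric] w(2)[OF assms(2), symmetric]
        w(2)[OF \<open>collinear_cells d e\<close>, symmetric] by simp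
    from arc_vec_independent3[OF line this] show ?thesis .
  qed simp
next
  case False
  have *: "w (i, j) (i, j') = w (i, j) (i', j)" if "i \<noteq> i'" "j \<noteq> j'" for i i' j j'
  proof -
    let ?c = "(i, j)" and ?d = "(i, j')" and ?e = "(i', j)" and ?f = "(i', j')"
    have K: "4 \<le> K" using K_rectangle that by blast
    have ne: "{?c, ?d, ?f} \<noteq> {?c, ?f}" "{?c, ?e, ?f} \<noteq> {?c, ?f}"
      "{?c, ?d, ?e, ?f} \<noteq> {?c, ?e}" "{?c, ?d, ?e, ?f} \<noteq> {?c, ?d}" using that by auto
    \<comment> \<open>The path passes through \<open>?f\<close> because \<open>{?d, ?e}\<close> is a
      diagonal and hence not nested: \<open>?c\<close> cannot be removed from
      \<open>{?c, ?d, ?e}\<close>.\<close>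
    have "\<kappa> {?c, ?d} ?c = \<kappa> {?c, ?d, ?f} ?c"
      using parallelogram[of "{?c, ?d, ?f}" ?c ?f] K that ne
      by (simp add: insert_Diff_if nested_def doubleton_eq_iff insert_commute)
    also have "\<dots> = \<kappa> {?c, ?d, ?e, ?f} ?c"
      using parallelogram[of "{?c, ?d, ?e, ?f}" ?c ?e] K that ne
      by (simp add: insert_Diff_if nested_def doubleton_eq_iff insert_commute)
    also have "\<dots> = \<kappa> {?c, ?e, ?f} ?c"
      using parallelogram[of "{?c, ?d, ?e, ?f}" ?c ?d] K that ne
      by (simp add: insert_Diff_if nested_def doubleton_eq_iff insert_commute)
    also have "\<dots> = \<kappa> {?c, ?e} ?c"
      using parallelogram[of "{?c, ?e, ?f}" ?c ?f] K that ne
      by (simp add: insert_Diff_if nested_def doubleton_eq_iff insert_commute)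
    finally show ?thesis
      using triangle[of ?c ?d] triangle[of ?c ?e] K that by (simp add: collinear_cells_def)
  qed
  consider "fst c = fst d" "snd c = snd e" "snd d \<noteq> snd c" "fst e \<noteq> fst c"
    | "snd c = snd d" "fst c = fst e" "fst d \<noteq> fst c" "snd e \<noteq> snd c"
    using False assms by (auto simp: collinear_cells_def prod_eq_iff)
  then show ?thesis
  proof cases
    case 1
    then show ?thesis using *[of "fst c" "fst e" "snd c" "snd d"] by (metis prod.collapse)
  next
    case 2
    then show ?thesis using *[of "fst c" "fst d" "snd c" "snd e"] by (metis prod.collapse)
  qed
qed

text \<open>Any two cells are joined by at most two collinear steps, through the corner
  \<open>(fst c, snd d)\<close>, and \<open>w_adjacent\<close> with symmetry carries the factor
  along each step.\<close>

lemma w_constant: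
  assumes "collinear_cells c c'" "collinear_cells d d'"
  shows "w c c' = w d d'"
proof -
  have step: "w c c' = w d d'" if "collinear_cells c d" "collinear_cells c c'" "collinear_cells d d'" for c c' d d'
    using that w_adjacent[of c c' d] w_sym[of c d] w_adjacent[of d c d'] collinear_cells_sym by metis
  consider "c = d" | "collinear_cells c d" | "fst c \<noteq> fst d" "snd c \<noteq> snd d"
    by (auto simp: collinear_cells_def)
  then show ?thesis
  proof cases
    case 1
    then show ?thesis using assms w_adjacent by metis
  next
    case 2
    then show ?thesis using assms step by metis
  next
    case 3
    let ?e = "(fst c, snd d)"
    have "collinear_cells c ?e" "collinear_cells ?e d"
      using 3 by (auto simp: collinear_cells_def prod_eq_iff)
    then show ?thesis using step[of c ?e c' d] step[of ?e d d d'] assms by simp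
  qed
qed

text \<open>Induction on the size: the cell \<open>d\<close> from \<open>nested_removable2\<close>
  is discarded by a parallelogram until only the pair \<open>{c, d}\<close> of
  \<open>triangle\<close> is left.\<close>

lemma \<kappa>_constant:
  assumes "nested F" "card F \<le> K" "c \<in> F" "nested (F - {c})" "F \<noteq> {c}"
    and \<mu>: "\<And>c d. collinear_cells c d \<Longrightarrow> w c d = \<mu>"
  shows "\<kappa> F c = \<mu>"
  using assms(1-5)
proof (induction "card F" arbitrary: F rule: less_induct)
  case less
  from less.prems(1,3-5) obtain d where d: "d \<in> F" "d \<noteq> c" "nested (F - {d})" "nested (F - {c} - {d})"
    by (rule nested_removable2)
  show ?case
  proof (cases "F = {c, d}")
    case True
    then have "collinear_cells c d" "2 \<le> K" using less.prems d nested_pair_iff[of c d] by auto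
    with triangle \<mu> show ?thesis unfolding True by metis
  next
    case False
    have smaller: "card (F - {d}) < card F" using d(1) by (meson card_Diff1_less finite)
    have comm: "F - {d} - {c} = F - {c} - {d}" by blast
    have "F - {d} \<noteq> {c}" using False d by (metis insert_Diff insert_commute)
    then have "\<kappa> (F - {d}) c = \<mu>"
      using less.hyps[OF smaller d(3)] less.prems smaller d by (simp add: comm)
    moreover have "\<kappa> F c = \<kappa> (F - {d}) c"
      using less.prems d False by (intro parallelogram) auto
    ultimately show ?thesis by simp
  qed
qed

lemma homothetic:
  obtains \<mu> x where "0 \<le> \<mu>"
    "\<And>F. nested F \<Longrightarrow> F \<noteq> {} \<Longrightarrow> card F \<le> K \<Longrightarrow> q F = x + \<mu> *\<^sub>R (\<Sum>c\<in>F. arc_vec c)"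
proof -
  obtain \<mu> where \<mu>: "0 \<le> \<mu>" "\<And>c d. collinear_cells c d \<Longrightarrow> w c d = \<mu>"
  proof (cases "\<exists>c d :: 'n \<times> 'm. collinear_cells c d")
    case True
    then obtain c d :: "'n \<times> 'm" where "collinear_cells c d" by blast
    with that[of "w c d"] w(1) w_constant show thesis by metis
  next
    \<comment> \<open>Without collinear pairs there is a single cell, and the factor
      \<open>0\<close> is a default.\<close>
    case False
    with that[of 0] show thesis by blast
  qed
  define c0 :: "'n \<times> 'm" where "c0 = undefined"
  define x where "x = q {c0} - \<mu> *\<^sub>R arc_vec c0"
  \<comment> \<open>Subtracting the expected displacement leaves a quantity that is the same for all
    singletons; its value at an arbitrary \<open>c0\<close> is the translation
    \<open>x\<close>.\<close>
  have collinear: "q {c} - \<mu> *\<^sub>R arc_vec c = q {d} - \<mu> *\<^sub>R arc_vec d" if "collinear_cells c d" for c d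
    using w(2)[OF that] \<mu>(2)[OF that] by (simp add: algebra_simps)
  have singleton: "q {c} = x + \<mu> *\<^sub>R arc_vec c" for c
  proof -
    let ?e = "(fst c, snd c0)"
    have "c = ?e \<or> collinear_cells c ?e" "?e = c0 \<or> collinear_cells ?e c0"
      by (auto simp: collinear_cells_def prod_eq_iff)
    then have "q {c} - \<mu> *\<^sub>R arc_vec c = q {c0} - \<mu> *\<^sub>R arc_vec c0"
      using collinear[of c ?e] collinear[of ?e c0] by metis
    then show ?thesis by (simp add: x_def algebra_simps)
  qed
  have "q F = x + \<mu> *\<^sub>R (\<Sum>c\<in>F. arc_vec c)" if "nested F" "F \<noteq> {}" "card F \<le> K" for F
    using that
  proof (induction "card F" arbitrary: F rule: less_induct)
    case less
    from less.prems(1,2) obtain c where c: "c \<in> F" "nested (F - {c})" by (rule nested_removable)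
    show ?case
    proof (cases "F = {c}")
      case True
      then show ?thesis by (simp add: singleton)
    next
      case False
      have smaller: "card (F - {c}) < card F" using c(1) by (meson card_Diff1_less finite)
      have "F - {c} \<noteq> {}" using False c by auto
      then have IH: "q (F - {c}) = x + \<mu> *\<^sub>R (\<Sum>c\<in>F - {c}. arc_vec c)"
        using less.hyps[OF smaller c(2)] less.prems(3) smaller by simp
      have "q F = q (F - {c}) + \<mu> *\<^sub>R arc_vec c"
        using \<kappa>[OF less.prems(1,3) c False] \<kappa>_constant[OF less.prems(1,3) c False \<mu>(2)]
        by (simp add: algebra_simps)
      also have "\<dots> = x + \<mu> *\<^sub>R (\<Sum>c\<in>F. arc_vec c)"
        unfolding IH using c(1) by (simp add: sum.remove[of F c] algebra_simps)
      finally show ?thesis .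
    qed
  qed
  with \<mu>(1) that show thesis by blast
qed

end

section \<open>The vertices of the truncated zonotopes\<close>

text \<open>\<open>f c\<close> is the position on the segment of the arc \<open>c\<close>, counted
  from its \<open>b\<close>-node, so the total flow is the sum of the
  \<open>a\<close>-coordinates.\<close>

definition flow_point :: "('n::finite \<times> 'm::finite \<Rightarrow> real) \<Rightarrow> real ^ ('n + 'm)" where
  "flow_point f = (\<Sum>c\<in>UNIV. axis (Inr (snd c)) 1 + f c *\<^sub>R arc_vec c)"

definition functional :: "('n::finite \<Rightarrow> real) \<Rightarrow> ('m::finite \<Rightarrow> real) \<Rightarrow> real ^ ('n + 'm)" where
  "functional \<alpha> \<beta> = (\<chi> v. case v of Inl i \<Rightarrow> \<alpha> i | Inr j \<Rightarrow> \<beta> j)"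

definition unit_flows :: "('n::finite \<times> 'm::finite \<Rightarrow> real) set" where
  "unit_flows = {f. \<forall>c. 0 \<le> f c \<and> f c \<le> 1}"

text \<open>The lower bound is the cut by the \<open>b\<close>-coordinates, whose sum is
  \<open>n m\<close> minus the total flow.\<close>

definition truncated :: "nat \<Rightarrow> (real ^ ('n::finite + 'm::finite)) set" where
  "truncated K = flow_point ` {f \<in> unit_flows. 1 \<le> sum f UNIV \<and> sum f UNIV \<le> real K}"

definition vertex :: "('n::finite \<times> 'm::finite) set \<Rightarrow> real ^ ('n + 'm)" where
  "vertex F = flow_point (\<lambda>c. of_bool (c \<in> F))"

lemma flow_point_add:
  "flow_point (\<lambda>c. f c + g c) = flow_point f + (\<Sum>c\<in>UNIV. g c *\<^sub>R arc_vec c)"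
  by (simp add: flow_point_def sum.distrib scaleR_left_distrib add.assoc)

lemma vertex_eq: "vertex F = vertex {} + (\<Sum>c\<in>F. arc_vec c)"
  using flow_point_add[of "\<lambda>c. 0" "\<lambda>c. of_bool (c \<in> F)"]
  by (simp add: vertex_def of_bool_def if_distrib[of "\<lambda>x. x *\<^sub>R _"] sum.If_cases cong: if_cong)

text \<open>A functional splits over the cells with weights \<alpha> - \<beta>, whose signs decide
  which cells a maximizing flow fills.\<close>

lemma functional_inner_flow_point:
  fixes f :: "'n::finite \<times> 'm::finite \<Rightarrow> real"
  shows "functional \<alpha> \<beta> \<bullet> flow_point f
    = (\<Sum>c\<in>(UNIV :: ('n \<times> 'm) set). \<beta> (snd c)) + (\<Sum>c\<in>UNIV. f c * (\<alpha> (fst c) - \<beta> (snd c)))"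
  by (simp add: flow_point_def arc_vec_def functional_def inner_sum_right inner_add_right
      inner_diff_right inner_axis sum.distrib)

lemma functional_inner:
  fixes x :: "real ^ ('n::finite + 'm::finite)"
  shows "functional \<alpha> \<beta> \<bullet> x = (\<Sum>i\<in>UNIV. \<alpha> i * x $ Inl i) + (\<Sum>j\<in>UNIV. \<beta> j * x $ Inr j)"
  unfolding inner_vec_def functional_def UNIV_Plus_UNIV[symmetric]
  by (subst sum.Plus) auto

section \<open>The zonotope and its truncations as sets of flow points\<close>

lemma segment_eq_image:
  "closed_segment (axis (Inl i) 1) (axis (Inr j) 1)
    = (\<lambda>t. axis (Inr j) 1 + t *\<^sub>R arc_vec (i, j)) ` {0..1}"
  by (subst closed_segment_commute, unfold closed_segment_image_interval, intro image_cong) (auto simp: arc_vec_def algebra_simps)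

lemma graphical_zonotope_eq:
  "(graphical_zonotope :: (real ^ ('n::finite + 'm::finite)) set) = flow_point ` unit_flows"
    (is "?Z = _")
proof -
  have "?Z = (\<Sum>c\<in>UNIV. (\<lambda>t. axis (Inr (snd c)) 1 + t *\<^sub>R arc_vec c) ` {0..1})"
    by (simp add: graphical_zonotope_def segment_eq_image sum.cartesian_product case_prod_unfold)
  also have "\<dots> = flow_point ` unit_flows"
  proof (intro equalityI subsetI)
    fix x :: "real ^ ('n + 'm)"
    assume "x \<in> (\<Sum>c\<in>UNIV. (\<lambda>t. axis (Inr (snd c)) 1 + t *\<^sub>R arc_vec c) ` {0..1})"
    then obtain s where x: "x = sum s UNIV"
      and "\<forall>c. s c \<in> (\<lambda>t. axis (Inr (snd c)) 1 + t *\<^sub>R arc_vec c) ` {0..1}"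
      by (auto simp: set_sum_alt)
    then have "\<forall>c. \<exists>t. t \<in> {0..1} \<and> s c = axis (Inr (snd c)) 1 + t *\<^sub>R arc_vec c" by blast
    then obtain f where "\<forall>c. f c \<in> {0..1} \<and> s c = axis (Inr (snd c)) 1 + f c *\<^sub>R arc_vec c"
      by metis
    with x have "x = flow_point f" "f \<in> unit_flows" by (simp_all add: flow_point_def unit_flows_def)
    then show "x \<in> flow_point ` unit_flows" by (rule image_eqI)
  next
    fix x :: "real ^ ('n + 'm)"
    assume "x \<in> flow_point ` unit_flows"
    then obtain f where "x = flow_point f" "f \<in> unit_flows" by (rule imageE)
    then show "x \<in> (\<Sum>c\<in>UNIV. (\<lambda>t. axis (Inr (snd c)) 1 + t *\<^sub>R arc_vec c) ` {0..1})"
      unfolding set_sum_alt[OF finite] flow_point_def unit_flows_def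
      by (intro CollectI exI[of _ "\<lambda>c. axis (Inr (snd c)) 1 + f c *\<^sub>R arc_vec c"]) simp
  qed
  finally show ?thesis .
qed

lemma compact_graphical_zonotope: "compact (graphical_zonotope :: (real ^ ('n::finite + 'm::finite)) set)"
proof -
  have plus: "compact (S + T)" if "compact S" "compact T" for S T :: "(real ^ ('n + 'm)) set"
  proof -
    have "S + T = {x + y | x y. x \<in> S \<and> y \<in> T}" by (auto simp: set_plus_def)
    with compact_sums[OF that] show ?thesis by simp
  qed
  have sum: "compact (\<Sum>i\<in>A. B i)" if "finite A" "\<And>i. i \<in> A \<Longrightarrow> compact (B i)"
    for A :: "'c set" and B :: "'c \<Rightarrow> (real ^ ('n + 'm)) set"
    using that by (induction A) (auto simp: set_zero intro: plus)
  show ?thesis unfolding graphical_zonotope_def by (intro sum) auto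
qed

lemma convex_graphical_zonotope: "convex graphical_zonotope"
  unfolding graphical_zonotope_def by (intro convex_set_sum) auto

lemma sum_coordinates_flow_point:
  fixes f :: "'n::finite \<times> 'm::finite \<Rightarrow> real"
  shows "functional (\<lambda>_. 1) (\<lambda>_. 0) \<bullet> flow_point f = sum f UNIV"
    "functional (\<lambda>_. 0) (\<lambda>_. 1) \<bullet> flow_point f = real CARD('n) * real CARD('m) - sum f UNIV"
  by (simp_all add: functional_inner_flow_point sum_negf)

lemma truncated_eq:
  "truncated K = (graphical_zonotope :: (real ^ ('n::finite + 'm::finite)) set)
     \<inter> {x. functional (\<lambda>_. 1) (\<lambda>_. 0) \<bullet> x \<le> real K}
     \<inter> {x. functional (\<lambda>_. 0) (\<lambda>_. 1) \<bullet> x \<le> real CARD('n) * real CARD('m) - 1}"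
    (is "_ = ?R")
proof (intro equalityI subsetI)
  fix x :: "real ^ ('n + 'm)"
  assume "x \<in> truncated K"
  then obtain f where "x = flow_point f" "f \<in> unit_flows" "1 \<le> sum f UNIV" "sum f UNIV \<le> real K"
    unfolding truncated_def by blast
  then show "x \<in> ?R" by (simp add: graphical_zonotope_eq sum_coordinates_flow_point)
next
  fix x :: "real ^ ('n + 'm)"
  assume x: "x \<in> ?R"
  then obtain f where "x = flow_point f" "f \<in> unit_flows" unfolding graphical_zonotope_eq by blast
  with x show "x \<in> truncated K"
    unfolding truncated_def by (intro image_eqI[of _ _ f]) (simp_all add: sum_coordinates_flow_point)
qed

text \<open>Entries of a flow are at most \<open>1\<close>, so the bound by the number of cells
  holds on the whole zonotope.\<close>

lemma P_polytope_eq: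
  "P_polytope = (truncated (CARD('n) * CARD('m)) :: (real ^ ('n::finite + 'm::finite)) set)"
proof -
  have "functional (\<lambda>_. 1) (\<lambda>_. 0) \<bullet> x \<le> real (CARD('n) * CARD('m))"
    if x: "x \<in> graphical_zonotope" for x :: "real ^ ('n + 'm)"
  proof -
    obtain f where f: "x = flow_point f" "f \<in> unit_flows"
      using x unfolding graphical_zonotope_eq by (rule imageE)
    then have "f c \<le> 1" for c by (cases c) (simp add: unit_flows_def)
    then have "sum f UNIV \<le> of_nat (card (UNIV :: ('n \<times> 'm) set)) * 1"
      by (intro sum_bounded_above)
    then show ?thesis by (simp add: f(1) sum_coordinates_flow_point)
  qed
  then show ?thesis
    unfolding truncated_eq P_polytope_def by (simp add: functional_inner) blast
qed

lemma Q_polytope_eq: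
  "Q_polytope = (truncated (CARD('n) * CARD('m) - 1) :: (real ^ ('n::finite + 'm::finite)) set)"
proof -
  have "real (CARD('n) * CARD('m) - 1) = real CARD('n) * real CARD('m) - 1"
    by (subst of_nat_diff) (simp_all add: Suc_le_eq)
  then show ?thesis
    unfolding truncated_eq Q_polytope_def P_polytope_def functional_inner by (simp add: Int_ac)
qed

lemma compact_truncated: "compact (truncated K)"
  and convex_truncated: "convex (truncated K)"
  unfolding truncated_eq
  by (intro compact_Int_closed closed_halfspace_le compact_graphical_zonotope)
    (intro convex_Int convex_halfspace_le convex_graphical_zonotope)

lemma vertex_in_truncated:
  assumes "F \<noteq> {}" "card F \<le> K"
  shows "vertex F \<in> truncated K"
proof -
  have "1 \<le> card F" using assms(1) by (simp add: Suc_le_eq card_gt_0_iff)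
  with assms(2) show ?thesis
    unfolding vertex_def truncated_def unit_flows_def by (intro imageI) simp
qed

section \<open>Extreme points of the truncated zonotopes\<close>

lemma extreme_point_of_imp_eq:
  assumes "x extreme_point_of S" "x + d \<in> S" "x - d \<in> S"
  shows "d = 0"
proof (rule ccontr)
  assume "d \<noteq> 0"
  have "x + d \<noteq> x - d"
  proof
    assume "x + d = x - d"
    then have "2 *\<^sub>R d = 0" by (simp add: scaleR_2 eq_diff_eq add.assoc)
    with \<open>d \<noteq> 0\<close> show False by simp
  qed
  moreover have "midpoint (x + d) (x - d) = x" by (simp add: midpoint_eq_iff)
  ultimately have "x \<in> open_segment (x + d) (x - d)"
    using midpoint_in_open_segment[of "x + d" "x - d"] by simp
  with assms show False unfolding extreme_point_of_def by blast
qed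

text \<open>In general \<open>flow_point\<close> is not injective, so a perturbation feasible in
  both directions need not vanish; only its image must.\<close>

lemma extreme_point_perturbation:
  assumes "flow_point f extreme_point_of truncated K"
    and "(\<lambda>c. f c + h c) \<in> unit_flows" "(\<lambda>c. f c - h c) \<in> unit_flows"
    and "1 \<le> sum f UNIV + sum h UNIV" "sum f UNIV + sum h UNIV \<le> real K"
    and "1 \<le> sum f UNIV - sum h UNIV" "sum f UNIV - sum h UNIV \<le> real K"
  shows "(\<Sum>c\<in>UNIV. h c *\<^sub>R arc_vec c) = 0"
proof (rule extreme_point_of_imp_eq[OF assms(1)])
  have "flow_point (\<lambda>c. f c + h c) \<in> truncated K" "flow_point (\<lambda>c. f c - h c) \<in> truncated K"
    unfolding truncated_def using assms(2-)
    by (intro imageI CollectI, simp add: sum.distrib sum_subtractf)+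
  then show "flow_point f + (\<Sum>c\<in>UNIV. h c *\<^sub>R arc_vec c) \<in> truncated K"
    "flow_point f - (\<Sum>c\<in>UNIV. h c *\<^sub>R arc_vec c) \<in> truncated K"
    using flow_point_add[of f h] flow_point_add[of f "\<lambda>c. - h c"] by (simp_all add: sum_negf)
qed

text \<open>A fractional entry can be shifted against a second one. If there is no second one, then the
  total flow is not an integer, so neither bound on it is tight.\<close>

lemma extreme_point_integral:
  assumes ext: "flow_point f extreme_point_of truncated K"
    and f: "f \<in> unit_flows" "1 \<le> sum f UNIV" "sum f UNIV \<le> real K"
  shows "f c = 0 \<or> f c = 1"
proof (rule ccontr)
  assume "\<not> ?thesis"
  have f01: "0 \<le> f d" "f d \<le> 1" for d
    using f(1) unfolding unit_flows_def by blast+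
  with \<open>\<not> ?thesis\<close> have c: "0 < f c" "f c < 1"
    by (simp_all add: less_le)
  show False
  proof (cases "\<exists>d. d \<noteq> c \<and> 0 < f d \<and> f d < 1")
    case True
    then obtain d where d: "d \<noteq> c" "0 < f d" "f d < 1" by blast
    define e where "e = min (min (f c) (1 - f c)) (min (f d) (1 - f d))"
    have e: "0 < e" "e \<le> f c" "e \<le> 1 - f c" "e \<le> f d" "e \<le> 1 - f d"
      using c d by (auto simp: e_def)
    define h where "h x = (if x = c then e else if x = d then - e else 0)" for x
    have "sum h UNIV = sum h {c, d}" by (intro sum.mono_neutral_right) (auto simp: h_def)
    then have sum: "sum h UNIV = 0" using d(1) by (simp add: h_def)
    have h: "0 \<le> f x + h x \<and> f x + h x \<le> 1 \<and> 0 \<le> f x - h x \<and> f x - h x \<le> 1" for x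
      using e c d f01[of x] by (auto simp: h_def)
    have "(\<Sum>x\<in>UNIV. h x *\<^sub>R arc_vec x) = 0"
      using f h by (intro extreme_point_perturbation[OF ext]) (simp_all add: sum unit_flows_def)
    moreover have "(\<Sum>x\<in>UNIV. h x *\<^sub>R arc_vec x) = (\<Sum>x\<in>{c, d}. h x *\<^sub>R arc_vec x)"
      by (intro sum.mono_neutral_right) (auto simp: h_def)
    ultimately have "e *\<^sub>R arc_vec c = e *\<^sub>R arc_vec d" using d(1) by (simp add: h_def)
    with e(1) d(1) show False using arc_vec_independent(1)[of c d e e] by simp
  next
    case False
    have int: "f d \<in> \<int>" if "d \<in> UNIV - {c}" for d
    proof -
      have "\<not> (0 < f d \<and> f d < 1)" using False that by blast
      then have "f d = 0 \<or> f d = 1" using f01[of d] by linarith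
      then show ?thesis by auto
    qed
    have sum_f: "sum f UNIV = f c + sum f (UNIV - {c})" by (simp add: sum.remove)
    have notin: "f c \<notin> \<int>"
    proof
      assume "f c \<in> \<int>"
      then obtain z where "f c = real_of_int z" by (rule Ints_cases)
      with c show False by simp
    qed
    have "sum f UNIV \<notin> \<int>"
    proof
      assume "sum f UNIV \<in> \<int>"
      moreover have "sum f (UNIV - {c}) \<in> \<int>" using int by (rule Ints_sum)
      ultimately have "sum f UNIV - sum f (UNIV - {c}) \<in> \<int>" by (rule Ints_diff)
      with notin show False by (simp add: sum_f)
    qed
    then have "sum f UNIV \<noteq> 1" "sum f UNIV \<noteq> real K" by (metis Ints_1, metis Ints_of_nat)
    with f have strict: "1 < sum f UNIV" "sum f UNIV < real K" by simp_all
    define e where "e = min (min (f c) (1 - f c)) (min (sum f UNIV - 1) (real K - sum f UNIV))"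
    have e: "0 < e" "e \<le> f c" "e \<le> 1 - f c" "e \<le> sum f UNIV - 1" "e \<le> real K - sum f UNIV"
      using c strict by (auto simp: e_def)
    define h where "h x = (if x = c then e else 0)" for x
    have sum: "sum h UNIV = e" by (simp add: h_def)
    have h: "0 \<le> f x + h x \<and> f x + h x \<le> 1 \<and> 0 \<le> f x - h x \<and> f x - h x \<le> 1" for x
      using e c f01[of x] by (auto simp: h_def)
    have "(\<Sum>x\<in>UNIV. h x *\<^sub>R arc_vec x) = 0"
      using e f h by (intro extreme_point_perturbation[OF ext]) (simp_all add: sum unit_flows_def)
    moreover have "(\<Sum>x\<in>UNIV. h x *\<^sub>R arc_vec x) = (\<Sum>x\<in>{c}. h x *\<^sub>R arc_vec x)"
      by (intro sum.mono_neutral_right) (auto simp: h_def)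
    ultimately show False using e(1) by (simp add: h_def)
  qed
qed

text \<open>Integrality holds for every flow representing \<open>x\<close>. It makes the given flow
  an indicator, and it excludes a forbidden rectangle by way of a second representation.\<close>

lemma extreme_point_vertex:
  assumes ext: "x extreme_point_of truncated K"
  obtains F where "x = vertex F" "nested F" "F \<noteq> {}" "card F \<le> K"
proof -
  have "x \<in> truncated K" using ext by (simp add: extreme_point_of_def)
  then obtain f where x: "x = flow_point f"
    and f: "f \<in> unit_flows" "1 \<le> sum f UNIV" "sum f UNIV \<le> real K"
    unfolding truncated_def by blast
  define F where "F = {c. f c = 1}"
  have f_eq: "f = (\<lambda>c. of_bool (c \<in> F))"
    using extreme_point_integral[OF ext[unfolded x] f] by (auto simp: F_def fun_eq_iff)
  have sum: "sum f UNIV = real (card F)" by (simp add: f_eq)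
  have "nested F"
  proof (rule ccontr)
    assume "\<not> nested F"
    then obtain i j i' j' where F: "(i, j) \<in> F" "(i', j') \<in> F" "(i, j') \<notin> F" "(i', j) \<notin> F"
      unfolding nested_def by blast
    \<comment> \<open>Half of the flow around the cycle cancels without moving the point, but it is fractional.\<close>
    define h :: "'a \<times> 'b \<Rightarrow> real" where
      "h c = (if c = (i, j) \<or> c = (i', j') then - 1 / 2
        else if c = (i, j') \<or> c = (i', j) then 1 / 2 else 0)" for c
    define R where "R = {(i, j), (i', j'), (i, j'), (i', j)}"
    have ne: "i \<noteq> i'" "j \<noteq> j'" using F by auto
    have sum_R: "(\<Sum>c\<in>UNIV. g c) = (\<Sum>c\<in>R. g c)" if "\<And>c. c \<notin> R \<Longrightarrow> g c = 0"
      for g :: "'a \<times> 'b \<Rightarrow> 'c::comm_monoid_add"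
      using that by (intro sum.mono_neutral_right) auto
    have h0: "h c = 0" if "c \<notin> R" for c using that by (auto simp: h_def R_def)
    have "sum h UNIV = sum h R" by (intro sum_R h0)
    then have "sum h UNIV = 0" using ne by (simp add: R_def h_def)
    have "(\<Sum>c\<in>UNIV. h c *\<^sub>R arc_vec c) = (\<Sum>c\<in>R. h c *\<^sub>R arc_vec c)"
      by (intro sum_R) (simp add: h0)
    also have "\<dots> = 0" using ne by (simp add: R_def h_def arc_vec_def algebra_simps)
    finally have "x = flow_point (\<lambda>c. f c + h c)" by (simp add: x flow_point_add)
    moreover have "(\<lambda>c. f c + h c) \<in> unit_flows"
      unfolding unit_flows_def using F by (auto simp: f_eq h_def)
    moreover have "sum (\<lambda>c. f c + h c) UNIV = sum f UNIV"
      by (simp add: sum.distrib \<open>sum h UNIV = 0\<close>)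
    ultimately have "f (i, j) + h (i, j) = 0 \<or> f (i, j) + h (i, j) = 1"
      using extreme_point_integral[of "\<lambda>c. f c + h c" K "(i, j)"] ext f by simp
    then show False using F by (simp add: f_eq h_def)
  qed
  moreover have "F \<noteq> {}" "card F \<le> K" using f(2,3) unfolding sum by auto
  moreover have "x = vertex F" by (simp add: x vertex_def f_eq[symmetric])
  ultimately show thesis using that by blast
qed

definition vertex_sets :: "nat \<Rightarrow> ('n::finite \<times> 'm::finite) set set" where
  "vertex_sets K = {F. nested F \<and> F \<noteq> {} \<and> card F \<le> K}"

lemma truncated_eq_hull:
  "(truncated K :: (real ^ ('n::finite + 'm::finite)) set) = convex hull (vertex ` vertex_sets K)"
    (is "?P = _")
proof
  have "truncated K = convex hull {x :: real ^ ('n + 'm). x extreme_point_of truncated K}"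
    by (rule Krein_Milman_Minkowski[OF compact_truncated convex_truncated])
  also have "\<dots> \<subseteq> convex hull (vertex ` vertex_sets K)"
  proof (rule hull_mono, rule subsetI)
    fix x :: "real ^ ('n + 'm)" assume "x \<in> {x. x extreme_point_of truncated K}"
    then have "x extreme_point_of truncated K" by simp
    then obtain F where "x = vertex F" "nested F" "F \<noteq> {}" "card F \<le> K"
      by (rule extreme_point_vertex)
    then show "x \<in> vertex ` vertex_sets K" by (simp add: vertex_sets_def)
  qed
  finally show "?P \<subseteq> convex hull (vertex ` vertex_sets K)" .
  have "vertex F \<in> truncated K" if "F \<in> vertex_sets K" for F :: "('n \<times> 'm) set"
    using that by (intro vertex_in_truncated) (simp_all add: vertex_sets_def)
  then show "convex hull (vertex ` vertex_sets K) \<subseteq> ?P"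
    by (intro hull_minimal convex_truncated image_subsetI)
qed

section \<open>Exposed edges and Minkowski summands\<close>

text \<open>For \<open>u\<close> and \<open>v\<close> in a convex \<open>P\<close>, this says that
  the segment is exactly the face of \<open>P\<close> on which \<open>g\<close> is maximal.\<close>

definition exposes :: "'a::euclidean_space \<Rightarrow> 'a set \<Rightarrow> 'a \<Rightarrow> 'a \<Rightarrow> bool" where
  "exposes g P u v \<longleftrightarrow> g \<bullet> v = g \<bullet> u \<and>
    (\<forall>x\<in>P. g \<bullet> x \<le> g \<bullet> u \<and> (g \<bullet> x = g \<bullet> u \<longrightarrow> x \<in> closed_segment u v))"

text \<open>With the heights of \<open>nested_corner_heights\<close>, a maximizing flow must be
  \<open>1\<close> on \<open>F - {c}\<close> and \<open>0\<close> outside \<open>F\<close>, and is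
  free only at \<open>c\<close>.\<close>

lemma removal_edge_exposed:
  fixes F :: "('n::finite \<times> 'm::finite) set"
  assumes F: "nested F" "nested (F - {c})" "c \<in> F"
  shows "\<exists>g. exposes g (truncated K) (vertex F) (vertex (F - {c}))"
proof -
  obtain \<alpha> :: "'n \<Rightarrow> real" and \<beta> :: "'m \<Rightarrow> real" where "\<alpha> (fst c) = \<beta> (snd c) \<and>
    (\<forall>d. (d \<in> F - {c} \<longrightarrow> \<beta> (snd d) < \<alpha> (fst d)) \<and> (d \<notin> F \<longrightarrow> \<alpha> (fst d) < \<beta> (snd d)))"
    using nested_corner_heights[OF F] by (elim exE)
  then have c: "\<alpha> (fst c) = \<beta> (snd c)" and d: "d \<in> F - {c} \<Longrightarrow> \<beta> (snd d) < \<alpha> (fst d)"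
    "d \<notin> F \<Longrightarrow> \<alpha> (fst d) < \<beta> (snd d)" for d by simp_all
  define \<delta> where "\<delta> d = \<alpha> (fst d) - \<beta> (snd d)" for d
  have \<delta>: "\<delta> c = 0" "d \<in> F - {c} \<Longrightarrow> 0 < \<delta> d" "d \<notin> F \<Longrightarrow> \<delta> d < 0" for d
    using c d(1,2)[of d] by (simp_all add: \<delta>_def)
  let ?g = "functional \<alpha> \<beta>" and ?b = "\<Sum>d\<in>(UNIV :: ('n \<times> 'm) set). \<beta> (snd d)"
  have val: "?g \<bullet> flow_point f = ?b + (\<Sum>d\<in>UNIV. f d * \<delta> d)" for f
    by (simp add: functional_inner_flow_point \<delta>_def)
  have "(\<Sum>d\<in>UNIV. of_bool (d \<in> F - {c}) * \<delta> d) = (\<Sum>d\<in>UNIV. of_bool (d \<in> F) * \<delta> d)"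
    using \<delta>(1) by (intro sum.cong) auto
  then have "?g \<bullet> vertex (F - {c}) = ?g \<bullet> vertex F" by (simp only: vertex_def val)
  moreover have "?g \<bullet> x \<le> ?g \<bullet> vertex F \<and>
      (?g \<bullet> x = ?g \<bullet> vertex F \<longrightarrow> x \<in> closed_segment (vertex F) (vertex (F - {c})))"
    if mem: "x \<in> truncated K" for x
  proof -
    obtain f where x: "x = flow_point f" and f01: "\<forall>d. 0 \<le> f d \<and> f d \<le> 1"
      using mem unfolding truncated_def unit_flows_def by blast
    from f01 have f: "0 \<le> f d" "f d \<le> 1" for d by blast+
    have le: "f d * \<delta> d \<le> of_bool (d \<in> F) * \<delta> d" for d
    proof -
      consider "d = c" | "d \<in> F - {c}" | "d \<notin> F" by blast
      then show ?thesis
        using \<delta>(1) \<delta>(2,3)[of d] f[of d] by cases (auto simp: mult_le_0_iff intro: mult_left_le_one_le)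
    qed
    have "x \<in> closed_segment (vertex F) (vertex (F - {c}))" if eq: "?g \<bullet> x = ?g \<bullet> vertex F"
    proof -
      have "(\<Sum>d\<in>UNIV. f d * \<delta> d) = (\<Sum>d\<in>UNIV. of_bool (d \<in> F) * \<delta> d)"
        using eq by (simp only: x vertex_def val add_left_cancel)
      \<comment> \<open>Equal sums of termwise ordered summands force equality in every
        term.\<close>
      then have tight: "f d * \<delta> d = of_bool (d \<in> F) * \<delta> d" for d
        by (rule sum_mono_inv[OF _ le]) simp_all
      have "f d = of_bool (d \<in> F - {c}) + (if d = c then f c else 0)" for d
        using tight[of d] \<delta>(2,3)[of d] F(3) by (cases "d = c"; cases "d \<in> F") auto
      then have "x = vertex (F - {c}) + (\<Sum>d\<in>UNIV. (if d = c then f c else 0) *\<^sub>R arc_vec d)"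
        unfolding x vertex_def flow_point_add[symmetric] by (intro arg_cong[of _ _ flow_point] ext)
      also have "(\<Sum>d\<in>UNIV. (if d = c then f c else 0) *\<^sub>R arc_vec d) = f c *\<^sub>R arc_vec c"
        by (simp add: if_distrib[of "\<lambda>x. x *\<^sub>R _"] cong: if_cong)
      finally have "x = (1 - (1 - f c)) *\<^sub>R vertex F + (1 - f c) *\<^sub>R vertex (F - {c})"
        using F(3) by (simp add: vertex_eq[of F] vertex_eq[of "F - {c}"] sum.remove[of F c] algebra_simps)
      with f show ?thesis unfolding in_segment(1) by (intro exI[of _ "1 - f c"]) simp
    qed
    moreover have "?g \<bullet> x \<le> ?g \<bullet> vertex F"
      unfolding x vertex_def val by (intro add_left_mono sum_mono le)
    ultimately show ?thesis by blast
  qed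
  ultimately show ?thesis unfolding exposes_def by (intro exI[of _ ?g]) blast
qed

text \<open>All weights are at most \<open>-1\<close> and the total flow is at least
  \<open>1\<close>, so the maximum is attained only by total flow \<open>1\<close> placed on the
  cells of weight exactly \<open>-1\<close>.\<close>

lemma exchange_edge_exposed:
  fixes c d :: "'n::finite \<times> 'm::finite"
  assumes cd: "collinear_cells c d"
  shows "\<exists>g. exposes g (truncated K) (vertex {c}) (vertex {d})"
proof -
  \<comment> \<open>Since \<open>c\<close> and \<open>d\<close> are collinear, their rows and
    columns cross only in \<open>c\<close> and \<open>d\<close>. The weight there is
    \<open>1 - 2\<close>; every other cell loses at least \<open>1\<close> more.\<close>
  define \<alpha> :: "'n \<Rightarrow> real" where "\<alpha> i = of_bool (i = fst c \<or> i = fst d)" for i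
  define \<beta> :: "'m \<Rightarrow> real" where "\<beta> j = 3 - of_bool (j = snd c \<or> j = snd d)" for j
  have ne: "c \<noteq> d" using cd by (simp add: collinear_cells_def)
  define \<delta> where "\<delta> e = \<alpha> (fst e) - \<beta> (snd e)" for e
  have \<delta>: "\<delta> c = -1" "\<delta> d = -1" "e \<noteq> c \<Longrightarrow> e \<noteq> d \<Longrightarrow> \<delta> e < -1" for e
    using cd by (auto simp: \<delta>_def \<alpha>_def \<beta>_def collinear_cells_def prod_eq_iff)
  have \<delta>_le: "\<delta> e \<le> -1" for e using \<delta>(1,2) less_imp_le[OF \<delta>(3)[of e]] by (cases "e = c \<or> e = d") auto
  let ?g = "functional \<alpha> \<beta>" and ?b = "\<Sum>d\<in>(UNIV :: ('n \<times> 'm) set). \<beta> (snd d)"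
  have val: "?g \<bullet> flow_point f = ?b + (\<Sum>d\<in>UNIV. f d * \<delta> d)" for f
    by (simp add: functional_inner_flow_point \<delta>_def)
  have vertices: "?g \<bullet> vertex {c} = ?b - 1" "?g \<bullet> vertex {d} = ?b - 1"
    by (simp_all add: vertex_def val \<delta>)
  have "?g \<bullet> x \<le> ?b - 1 \<and> (?g \<bullet> x = ?b - 1 \<longrightarrow> x \<in> closed_segment (vertex {c}) (vertex {d}))"
    if mem: "x \<in> truncated K" for x
  proof -
    obtain f where x: "x = flow_point f" and f01: "\<forall>d. 0 \<le> f d \<and> f d \<le> 1" and sum_f: "1 \<le> sum f UNIV"
      using mem unfolding truncated_def unit_flows_def by blast
    from f01 have f: "0 \<le> f d" "f d \<le> 1" for d by blast+
    have le: "f e * \<delta> e \<le> - f e" for e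
      using mult_left_mono[OF \<delta>_le f(1)] by simp
    have bound: "(\<Sum>e\<in>UNIV. f e * \<delta> e) \<le> (\<Sum>e\<in>UNIV. - f e)" by (intro sum_mono le)
    have "x \<in> closed_segment (vertex {c}) (vertex {d})" if "?g \<bullet> x = ?b - 1"
    proof -
      have "(\<Sum>e\<in>UNIV. f e * \<delta> e) = - 1" using that by (simp add: x val)
      with bound sum_f have one: "sum f UNIV = 1" and "(\<Sum>e\<in>UNIV. f e * \<delta> e) = (\<Sum>e\<in>UNIV. - f e)"
        by (simp_all add: sum_negf)
      from this(2) have tight: "f e * \<delta> e = - f e" for e
        by (rule sum_mono_inv[OF _ le]) simp_all
      have zero: "f e = 0" if "e \<notin> {c, d}" for e
      proof -
        have "f e * (\<delta> e + 1) = 0" using tight[of e] by (simp add: algebra_simps)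
        with \<delta>(3)[of e] that show ?thesis by auto
      qed
      have "sum f UNIV = sum f {c, d}" using zero by (intro sum.mono_neutral_right) auto
      then have fd: "f c = 1 - f d" using one ne by simp
      have "x = flow_point (\<lambda>c. 0 + f c)" by (simp add: x)
      also have "\<dots> = vertex {} + (\<Sum>e\<in>UNIV. f e *\<^sub>R arc_vec e)"
        unfolding flow_point_add by (simp add: vertex_def)
      also have "(\<Sum>e\<in>UNIV. f e *\<^sub>R arc_vec e) = (\<Sum>e\<in>{c, d}. f e *\<^sub>R arc_vec e)"
        using zero by (intro sum.mono_neutral_right) auto
      finally have "x = (1 - f d) *\<^sub>R vertex {c} + f d *\<^sub>R vertex {d}"
        using ne by (simp add: vertex_eq[of "{c}"] vertex_eq[of "{d}"] fd algebra_simps)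
      with f show ?thesis unfolding in_segment(1) by (intro exI[of _ "f d"]) simp
    qed
    moreover have "?g \<bullet> x \<le> ?b - 1"
      using bound sum_f by (simp add: x val sum_negf)
    ultimately show ?thesis by blast
  qed
  then show ?thesis
    unfolding exposes_def by (intro exI[of _ ?g], unfold vertices) blast
qed

text \<open>The mixed sums \<open>a' + b\<close> and \<open>a + b'\<close> have the same total
  \<open>g\<close>-value as the two maximal points \<open>a + b\<close> and \<open>a' + b'\<close>,
  so both are maximal. Hence \<open>a' + b\<close> lies on the dilated edge, and its distance from
  \<open>a + b\<close> along it is that between \<open>a'\<close> and \<open>a\<close>.\<close>

lemma exposed_edge_summand:
  assumes sum: "(\<lambda>x. s *\<^sub>R x) ` P = Q + R" and s: "0 < s"
    and g: "exposes g P u v"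
    and u: "a \<in> Q" "b \<in> R" "s *\<^sub>R u = a + b"
    and v: "a' \<in> Q" "b' \<in> R" "s *\<^sub>R v = a' + b'"
  shows "\<exists>t\<ge>0. a - a' = t *\<^sub>R (u - v)"
proof -
  have le: "g \<bullet> y \<le> s * (g \<bullet> u)" if y: "y \<in> Q + R" for y
  proof -
    obtain x where "x \<in> P" "y = s *\<^sub>R x" using y unfolding sum[symmetric] by blast
    with g s show ?thesis unfolding exposes_def by simp
  qed
  have mem: "a' + b \<in> Q + R" "a + b' \<in> Q + R" using u v by (auto intro: set_plus_intro)
  obtain z where z: "z \<in> P" "a' + b = s *\<^sub>R z" using mem(1) unfolding sum[symmetric] by blast
  have "g \<bullet> (s *\<^sub>R u) = g \<bullet> (a + b)" "g \<bullet> (s *\<^sub>R v) = g \<bullet> (a' + b')" by (simp_all only: u v)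
  moreover have "g \<bullet> v = g \<bullet> u" using g by (simp add: exposes_def)
  ultimately have "s * (g \<bullet> u) \<le> g \<bullet> (a' + b)"
    using le[OF mem(2)] by (simp add: inner_add_right)
  then have "g \<bullet> z = g \<bullet> u" using le[OF mem(1)] s unfolding z(2) by simp
  then have "z \<in> closed_segment u v" using g z(1) by (auto simp: exposes_def)
  then obtain k where k: "0 \<le> k" "z = (1 - k) *\<^sub>R u + k *\<^sub>R v" unfolding in_segment by blast
  have "a - a' = s *\<^sub>R u - s *\<^sub>R z" unfolding u(3) z(2)[symmetric] by simp
  also have "\<dots> = (s * k) *\<^sub>R (u - v)" by (simp add: k algebra_simps)
  finally show ?thesis using s k by (intro exI[of _ "s * k"]) simp
qed

text \<open>If \<open>z\<close> is strictly separated from \<open>A\<close> by \<open>g\<close>,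
  then adding to \<open>z\<close> a point of \<open>R\<close> with least \<open>g\<close>-value
  gives a sum below everything in \<open>A + R\<close>.\<close>

lemma Minkowski_cancellation:
  fixes A :: "'a::euclidean_space set"
  assumes "convex A" "closed A" "compact R" "R \<noteq> {}" and sub: "Q + R \<subseteq> A + R"
  shows "Q \<subseteq> A"
proof (rule subsetI, rule ccontr)
  fix z assume z: "z \<in> Q" "z \<notin> A"
  obtain g b where b: "g \<bullet> z < b" "\<forall>x\<in>A. b < g \<bullet> x"
    using separating_hyperplane_closed_point[OF assms(1,2) z(2)] by blast
  have "continuous_on R (\<lambda>y. g \<bullet> y)" by (intro continuous_intros)
  then obtain r where r: "r \<in> R" "\<forall>y\<in>R. g \<bullet> r \<le> g \<bullet> y"
    using continuous_attains_inf[OF assms(3,4)] by blast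
  have "z + r \<in> A + R" using sub z(1) r(1) by (auto intro: set_plus_intro)
  then obtain a r' where a: "a \<in> A" "r' \<in> R" "z + r = a + r'" by (rule set_plus_elim)
  then have "g \<bullet> z + g \<bullet> r = g \<bullet> a + g \<bullet> r'" by (metis inner_add_right)
  with b(1) bspec[OF b(2) a(1)] bspec[OF r(2) a(2)] show False by linarith
qed

text \<open>Each dilated vertex is split into a point \<open>q F\<close> of the summand and a point
  of the complement. Rigidity makes \<open>q\<close> a homothety on the vertices, and cancellation
  shows that these points span the summand.\<close>

lemma truncated_indecomposable:
  fixes K :: nat
  assumes K: "1 \<le> K" "2 \<le> CARD('n) \<Longrightarrow> 2 \<le> CARD('m) \<Longrightarrow> 4 \<le> K"
  shows "indecomposable (truncated K :: (real ^ ('n::finite + 'm::finite)) set)"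
  unfolding indecomposable_def
proof (intro conjI allI impI)
  let ?P = "truncated K :: (real ^ ('n + 'm)) set"
  let ?S = "vertex_sets K :: ('n \<times> 'm) set set"
  show "polytope ?P" unfolding truncated_eq_hull polytope_def
    by (intro exI[of _ "vertex ` ?S"] conjI refl finite_imageI finite)
  have S: "{c} \<in> ?S" for c using K(1) by (simp add: vertex_sets_def)
  then show "?P \<noteq> {}" unfolding truncated_eq_hull convex_hull_eq_empty by blast
  fix Q :: "(real ^ ('n + 'm)) set"
  assume "deformation_of Q ?P"
  then obtain s R where Q: "polytope Q" and s: "0 < s" and R: "polytope R" "R \<noteq> {}"
    and sum: "(\<lambda>x. s *\<^sub>R x) ` ?P = Q + R"
    unfolding deformation_of_def by blast
  have "\<forall>F\<in>?S. \<exists>a. a \<in> Q \<and> (\<exists>b\<in>R. s *\<^sub>R vertex F = a + b)"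
  proof
    fix F assume "F \<in> ?S"
    then have "vertex F \<in> ?P" by (simp add: truncated_eq_hull hull_inc)
    then have "s *\<^sub>R vertex F \<in> Q + R" unfolding sum[symmetric] by (rule imageI)
    then show "\<exists>a. a \<in> Q \<and> (\<exists>b\<in>R. s *\<^sub>R vertex F = a + b)"
      unfolding set_plus_def by blast
  qed
  then obtain q where "\<forall>F\<in>?S. q F \<in> Q \<and> (\<exists>b\<in>R. s *\<^sub>R vertex F = q F + b)"
    by (rule bchoice[THEN exE])
  then have q: "q F \<in> Q" "\<exists>b\<in>R. s *\<^sub>R vertex F = q F + b" if "F \<in> ?S" for F
    using that by simp_all
  have edge: "\<exists>t\<ge>0. q F - q G = t *\<^sub>R (vertex F - vertex G)"
    if F: "F \<in> ?S" and G: "G \<in> ?S" and ex: "\<exists>g. exposes g ?P (vertex F) (vertex G)" for F G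
  proof -
    obtain g where g: "exposes g ?P (vertex F) (vertex G)" using ex by (rule exE)
    obtain b where b: "b \<in> R" "s *\<^sub>R vertex F = q F + b" using q(2)[OF F] by (rule bexE)
    obtain b' where b': "b' \<in> R" "s *\<^sub>R vertex G = q G + b'" using q(2)[OF G] by (rule bexE)
    show ?thesis
      by (rule exposed_edge_summand[OF sum s g q(1)[OF F] b q(1)[OF G] b'])
  qed
  have "rigid_vertices K q"
  proof
    show "1 \<le> K" by (rule K(1))
    show "4 \<le> K" if "i \<noteq> i'" "j \<noteq> j'" for i i' :: 'n and j j' :: 'm
    proof -
      have "card {i, i'} \<le> CARD('n)" "card {j, j'} \<le> CARD('m)" by (intro card_mono; simp)+
      with that K(2) show ?thesis by simp
    qed
    show "\<exists>t\<ge>0. q F - q (F - {c}) = t *\<^sub>R arc_vec c"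
      if "nested F" "card F \<le> K" "c \<in> F" "nested (F - {c})" "F \<noteq> {c}" for F c
    proof -
      have "F - {c} \<noteq> {}" using that by auto
      moreover have "card (F - {c}) \<le> K" using that(2) by (meson card_Diff1_le le_trans)
      ultimately have "F \<in> ?S" "F - {c} \<in> ?S" using that by (auto simp: vertex_sets_def)
      moreover have "vertex F - vertex (F - {c}) = arc_vec c"
        using that(3) by (simp add: vertex_eq[of F] vertex_eq[of "F - {c}"] sum.remove[of F c])
      ultimately show ?thesis
        using edge[of F "F - {c}"] removal_edge_exposed[OF that(1,4,3)] by simp
    qed
    show "\<exists>t\<ge>0. q {c} - q {d} = t *\<^sub>R (arc_vec c - arc_vec d)" if "collinear_cells c d" for c d
      using edge[OF S S exchange_edge_exposed[OF that]]
      by (simp add: vertex_eq[of "{c}"] vertex_eq[of "{d}"])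
  qed
  then obtain \<mu> x where \<mu>: "0 \<le> \<mu>"
    and x: "\<And>F. nested F \<Longrightarrow> F \<noteq> {} \<Longrightarrow> card F \<le> K \<Longrightarrow> q F = x + \<mu> *\<^sub>R (\<Sum>c\<in>F. arc_vec c)"
    using rigid_vertices.homothetic by metis
  \<comment> \<open>\<open>x\<close> is the translation relative to the flow \<open>0\<close>;
    \<open>t\<close> corrects for its point \<open>vertex {}\<close>, which lies outside the
    truncation.\<close>
  define t where "t = x - \<mu> *\<^sub>R vertex {}"
  have q_eq: "q F = t + \<mu> *\<^sub>R vertex F" if "F \<in> ?S" for F
    using x[of F] that by (simp add: vertex_sets_def t_def vertex_eq[of F] algebra_simps)
  let ?A = "convex hull (q ` ?S)"
  have A: "compact ?A" by (intro finite_imp_compact_convex_hull) simp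
  \<comment> \<open>Every dilated vertex lies in \<open>?A + R\<close>, hence so does all of
    \<open>Q + R\<close>, and \<open>R\<close> can be cancelled.\<close>
  have "Q + R = convex hull ((\<lambda>x. s *\<^sub>R x) ` vertex ` ?S)"
    unfolding sum[symmetric] truncated_eq_hull convex_hull_scaling ..
  also have "\<dots> \<subseteq> ?A + R"
  proof (rule hull_minimal)
    show "(\<lambda>x. s *\<^sub>R x) ` vertex ` ?S \<subseteq> ?A + R"
    proof clarify
      fix F assume F: "F \<in> ?S"
      then obtain b where b: "b \<in> R" "s *\<^sub>R vertex F = q F + b" using q(2) by blast
      have "q F \<in> ?A" using F by (intro hull_inc imageI)
      with b show "s *\<^sub>R vertex F \<in> ?A + R" by (simp add: set_plus_intro)
    qed
    show "convex (?A + R)" using R by (intro convex_set_plus convex_convex_hull polytope_imp_convex)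
  qed
  finally have "Q \<subseteq> ?A"
    using A R by (intro Minkowski_cancellation[of ?A R Q])
      (auto intro: compact_imp_closed polytope_imp_compact)
  moreover have "?A \<subseteq> Q"
    using Q q(1) by (intro hull_minimal polytope_imp_convex) auto
  ultimately have "Q = ?A" by (rule equalityI)
  also have "q ` ?S = (\<lambda>x. t + \<mu> *\<^sub>R x) ` vertex ` ?S"
    unfolding image_image by (intro image_cong q_eq refl)
  also have "convex hull \<dots> = (\<lambda>x. \<mu> *\<^sub>R x + t) ` ?P"
    unfolding convex_hull_affinity truncated_eq_hull by (simp add: add.commute)
  finally show "\<exists>c t. 0 \<le> c \<and> Q = (\<lambda>x. c *\<^sub>R x + t) ` ?P" using \<mu> by blast
qed

theorem theorem3p3p10:
  "indecomposable (P_polytope :: (real ^ ('n::finite + 'm::finite)) set) \<and>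
   ((CARD('n), CARD('m)) \<noteq> (2, 2) \<and> (CARD('n), CARD('m)) \<noteq> (1, 1) \<longrightarrow>
     indecomposable (Q_polytope :: (real ^ ('n + 'm)) set))"
proof (intro conjI impI)
  show "indecomposable (P_polytope :: (real ^ ('n + 'm)) set)"
    unfolding P_polytope_eq
  proof (rule truncated_indecomposable)
    show "1 \<le> CARD('n) * CARD('m)" by (simp add: Suc_le_eq)
    show "4 \<le> CARD('n) * CARD('m)" if "2 \<le> CARD('n)" "2 \<le> CARD('m)"
      using mult_le_mono[OF that] by simp
  qed
next
  assume ne: "(CARD('n), CARD('m)) \<noteq> (2, 2) \<and> (CARD('n), CARD('m)) \<noteq> (1, 1)"
  have pos: "1 \<le> CARD('n)" "1 \<le> CARD('m)" by (simp_all add: Suc_le_eq)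
  show "indecomposable (Q_polytope :: (real ^ ('n + 'm)) set)"
    unfolding Q_polytope_eq
  proof (rule truncated_indecomposable)
    \<comment> \<open>Excluding \<open>(1, 1)\<close> leaves at least two cells, so the upper bound
      on the flow is at least \<open>1\<close>.\<close>
    consider "2 \<le> CARD('n)" | "2 \<le> CARD('m)" using ne pos unfolding prod.inject by arith
    then have "2 \<le> CARD('n) * CARD('m)"
      using mult_le_mono[of 2 "CARD('n)" 1 "CARD('m)"] mult_le_mono[of 1 "CARD('n)" 2 "CARD('m)"] pos
      by cases simp_all
    then show "1 \<le> CARD('n) * CARD('m) - 1" by simp
    show "4 \<le> CARD('n) * CARD('m) - 1" if big: "2 \<le> CARD('n)" "2 \<le> CARD('m)"
    proof -
      \<comment> \<open>Excluding \<open>(2, 2)\<close> leaves at least six cells, so a full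
        rectangle survives the cut.\<close>
      consider "3 \<le> CARD('n)" | "3 \<le> CARD('m)" using ne big unfolding prod.inject by arith
      then have "6 \<le> CARD('n) * CARD('m)"
        using mult_le_mono[of 3 "CARD('n)" 2 "CARD('m)"] mult_le_mono[of 2 "CARD('n)" 3 "CARD('m)"] big
        by cases simp_all
      then show ?thesis by simp
    qed
  qed
qed

end
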